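(* Let $\mathcal F=\{x\in\mathbb R^m: Ax=b,\ x\ge 0\}$ be the feasible set of one layer of the segmentation problem, with $A,b$, the admissible edge set $E$, the source masses $N^{(i)}$ and the target counts defined in the context. 1. The map $x\mapsto z$, $z^{(i,j)}=N^{(i)}x^{(i,j)}$ for $(i,j)\in E$, is an affine isomorphism of $\mathcal F$ onto the transportation polytope with slack sink and structural zeros $$\mathcal T=\Bigl\{z\in\mathbb R^{E}_{\ge0}:\ \sum_{j:(i,j)\in E}z^{(i,j)}=N^{(i)}\text{ for every source }i,\ \ \sum_{i:(i,j)\in E}z^{(i,j)}=N^{(j)}(t+1)\text{ for every target }j\ne\mathrm{dep}\Bigr\},$$ in which the departure column has no prescribed sum, each passive target of index $1,\dots,n$ has exactly two admissible entries, the reserve target has exactly one, and the reserve row has the effective mass $N_{\mathrm{eff}}^{(0)}$. 2. Assume $\mathcal F\neq\varnothing$. The minimum-norm point of $\mathcal F$ (the minimiser of $\|x\|$ over $\mathcal F$) corresponds under this map to the weighted-quadratic transport plan with source weights $1/(N^{(i)})^2$: the minimiser over $\mathcal T$ of $\sum_{(i,j)\in E}(z^{(i,j)})^2/(N^{(i)})^2$. This plan has the clipped potential form $z^{(i,j)}=\max\bigl(a_i+(N^{(i)})^2b_j,\,0\bigr)$, $(i,j)\in E$, for some real potentials $a_i$ (sources) and $b_j$ (targets). 3. If all source masses $N^{(i)}$ are equal, it reduces to the standard quadratically regularised ($\ell_2$) plan on $\mathcal T$, i.e. the minimiser of $\sum_{(i,j)\in E}(z^{(i,j)})^2$ over $\mathcal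 T$, with additive potentials $z^{(i,j)}=\max(a_i+b_j,0)$. 4. On the outflow simplex $\{q\in\mathbb R^k_{\ge0}:\sum_{r=1}^k q_r=1\}$ of a single source with $k$ admissible targets (normalisation constraint alone), the minimum-norm point is the uniform outflow $q_r=1/k$, and it coincides with the maximiser of the Shannon entropy $-\sum_r q_r\log q_r$.
   Context: Fix an integer $n\ge 1$ and an instant $t$. The data are: counts at time $t$, $N_1^{(i)}(t)>0$ for $i=1,\dots,n$ (active clusters) and $N_2^{(i)}(t)>0$ for $i=0,\dots,n$ (passive clusters; index $0$ is the reserve); nonnegative counts $N_1^{(i)}(t+1)$, $N_2^{(i)}(t+1)$ at time $t+1$; and an exogenous inflow $\Delta N_2^{(0)}(t)\ge 0$. Put $N_{\mathrm{eff}}^{(0)}=\Delta N_2^{(0)}(t)+N_2^{(0)}(t)$. The unknown vector $x\in\mathbb R^m$, $m=2n^2+5n+2$, has the components $P_{11}^{(i,j)}$ ($1\le i\le n$, $j\in\{1,\dots,n+1\}\setminus\{i\}$), $P_{12}^{(i)}$ ($1\le i\le n$), $P_{21}^{(i,j)}$ ($0\le i\le n$, $1\le j\le n+1$), $P^{*(i)}$ ($0\le i\le n$), $P^{**(i)}$ ($1\le i\le n$); the destination index $j=n+1$ means departure. With $p=4n+2$, the matrix $A\in\mathbb R^{p\times m}$ and vector $b\in\mathbb R^p$ are defined by declaring $Ax=b$ to be the following system. Balance equations: for $i=1,\dots,n$, $$\sum_{j=1}^n N_2^{(j)}(t)P_{21}^{(j,i)}+N_{\mathrm{eff}}^{(0)}P_{21}^{(0,i)}+\sum_{j\le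 n,\,j\ne i}N_1^{(j)}(t)P_{11}^{(j,i)}-N_1^{(i)}(t)\Bigl[P_{12}^{(i)}+\sum_{j\le n+1,\,j\neq i}P_{11}^{(i,j)}\Bigr]=N_1^{(i)}(t+1)-N_1^{(i)}(t);$$ $$-N_{\mathrm{eff}}^{(0)}\sum_{j=1}^{n+1}P_{21}^{(0,j)}=N_2^{(0)}(t+1)-N_2^{(0)}(t)-\Delta N_2^{(0)}(t);$$ and for $i=1,\dots,n$, $\;N_1^{(i)}(t)P_{12}^{(i)}-N_2^{(i)}(t)\sum_{j=1}^{n+1}P_{21}^{(i,j)}=N_2^{(i)}(t+1)-N_2^{(i)}(t)$. Normalisation equations: $P_{12}^{(i)}+\sum_{j\le n+1,\,j\ne i}P_{11}^{(i,j)}+P^{**(i)}=1$ for $i=1,\dots,n$, and $\sum_{j=1}^{n+1}P_{21}^{(i,j)}+P^{*(i)}=1$ for $i=0,\dots,n$. Admissible transition graph: the sources are the $2n+1$ clusters at time $t$ (active $1,\dots,n$; passive $0,\dots,n$), the targets are the $2n+1$ clusters at time $t+1$ together with departure $\mathrm{dep}$. Each component of $x$ is one edge $(i,j)\in E$ from a source $i$ to a target $j$, and is written $x^{(i,j)}$: $P_{11}^{(i,j)}$ joins active source $i$ to active target $j$ (or to $\mathrm{dep}$ if $j=n+1$); $P_{12}^{(i)}$ joins active source $i$ to passive target $i$; $P_{21}^{(i,j)}$ joins passive source $i$ to active target $j$ (or to $\mathrm{dep}$ if $j=n+1$); $P^{*(i)}$ joins passive source $i$ to passive target $i$; $P^{**(i)}$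 joins active source $i$ to active target $i$. The source mass $N^{(i)}$ is $N_1^{(i)}(t)$ for active source $i$, $N_2^{(i)}(t)$ for passive source $i\ge1$, and $N_{\mathrm{eff}}^{(0)}$ for the reserve source; $N^{(j)}(t+1)$ is the count at time $t+1$ of the target cluster $j$. *)

theory Defs
  imports "HOL-Analysis.Analysis"
begin

text \<open>
  The index set \<open>{1..n}\<close> is the type \<open>'n\<close>, so \<open>n = CARD('n)\<close>.  \<open>Reserve\<close> is the passive cluster of
  index \<open>0\<close>.  A function \<open>N :: 'n cluster \<Rightarrow> real\<close> holds the counts of one instant:
  \<open>N (Active i)\<close> is \<open>N\<^sub>1\<^sup>(i)\<close>, \<open>N (Passive i)\<close> is \<open>N\<^sub>2\<^sup>(i)\<close> and \<open>N Reserve\<close> is \<open>N\<^sub>2\<^sup>(0)\<close>.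
\<close>

datatype 'n cluster = Active 'n | Passive 'n | Reserve

datatype 'n target = To "'n cluster" | Dep

datatype 'n row = BalActive 'n | BalReserve | BalPassive 'n | Norm "'n cluster"

lemma UNIV_cluster: "(UNIV :: 'n cluster set) = range Active \<union> (range Passive \<union> {Reserve})"
  (is "_ = ?rhs")
proof (rule set_eqI)
  fix c :: "'n cluster"
  show "c \<in> UNIV \<longleftrightarrow> c \<in> ?rhs"
    by (cases c) simp_all
qed

lemma UNIV_target: "(UNIV :: 'n target set) = insert Dep (range To)"
  (is "_ = ?rhs")
proof (rule set_eqI)
  fix c :: "'n target"
  show "c \<in> UNIV \<longleftrightarrow> c \<in> ?rhs"
    by (cases c) simp_all
qed

lemma UNIV_row:
  "(UNIV :: 'n row set) = range BalActive \<union> (range BalPassive \<union> (range Norm \<union> {BalReserve}))"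
  (is "_ = ?rhs")
proof (rule set_eqI)
  fix c :: "'n row"
  show "c \<in> UNIV \<longleftrightarrow> c \<in> ?rhs"
    by (cases c) simp_all
qed

instance cluster :: (finite) finite
  by standard (simp add: UNIV_cluster)

instance target :: (finite) finite
  by standard (simp add: UNIV_target)

instance row :: (finite) finite
  by standard (simp add: UNIV_row)


subsection \<open>The admissible edges\<close>

text \<open>The destination indices \<open>j \<in> {1..n+1}\<close>; \<open>Dep\<close> is \<open>j = n+1\<close>.\<close>

definition dests :: "'n target set" where
  "dests = insert Dep (range (\<lambda>j. To (Active j)))"

definition passives :: "'n cluster set" where
  "passives = insert Reserve (range Passive)"

text \<open>
  One set for each family of unknowns, in the order \<open>P\<^sub>1\<^sub>1\<close>, \<open>P\<^sub>1\<^sub>2\<close>, \<open>P\<^sub>2\<^sub>1\<close>, \<open>P\<^sup>*\<close>, \<open>P\<^sup>*\<^sup>*\<close>.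
\<close>

definition admissible :: "('n cluster \<times> 'n target) set" where
  "admissible =
     {(Active i, d) | i d. d \<in> dests - {To (Active i)}} \<union>
     {(Active i, To (Passive i)) | i. True} \<union>
     {(c, d) | c d. c \<in> passives \<and> d \<in> dests} \<union>
     {(c, To c) | c. c \<in> passives} \<union>
     {(Active i, To (Active i)) | i. True}"

typedef 'n edge = "admissible :: ('n cluster \<times> 'n target) set"
  morphisms ends edge
proof
  show "(Reserve, Dep) \<in> admissible"
    by (simp add: admissible_def passives_def dests_def)
qed

instance edge :: (finite) finite
proof
  have "inj (ends :: 'a edge \<Rightarrow> _)"
    by (simp add: inj_on_def ends_inject)
  then show "finite (UNIV :: 'a edge set)"
    by (rule finite_imageD[rotated]) simp
qed

text \<open>
  The component \<open>x\<^sup>(i,j)\<close> of \<open>x \<in> \<real>\<^sup>E\<close>; it is meaningful only for \<open>(i, j) \<in> admissible\<close>.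
\<close>

abbreviation entry :: "real ^ 'n::finite edge \<Rightarrow> 'n cluster \<Rightarrow> 'n target \<Rightarrow> real" where
  "entry x i j \<equiv> x $ edge (i, j)"


subsection \<open>The linear system\<close>

text \<open>The source masses; the reserve carries the effective mass.\<close>

fun mass :: "('n cluster \<Rightarrow> real) \<Rightarrow> real \<Rightarrow> 'n cluster \<Rightarrow> real" where
  "mass N dN (Active i) = N (Active i)"
| "mass N dN (Passive i) = N (Passive i)"
| "mass N dN Reserve = dN + N Reserve"

fun lhs :: "('n::finite cluster \<Rightarrow> real) \<Rightarrow> real \<Rightarrow> real ^ 'n edge \<Rightarrow> 'n row \<Rightarrow> real" where
  "lhs N dN x (BalActive i) =
     (\<Sum>j\<in>UNIV. N (Passive j) * entry x (Passive j) (To (Active i)))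
     + (dN + N Reserve) * entry x Reserve (To (Active i))
     + (\<Sum>j\<in>UNIV - {i}. N (Active j) * entry x (Active j) (To (Active i)))
     - N (Active i) * (entry x (Active i) (To (Passive i))
                       + (\<Sum>d\<in>dests - {To (Active i)}. entry x (Active i) d))"
| "lhs N dN x BalReserve = - (dN + N Reserve) * (\<Sum>d\<in>dests. entry x Reserve d)"
| "lhs N dN x (BalPassive i) =
     N (Active i) * entry x (Active i) (To (Passive i))
     - N (Passive i) * (\<Sum>d\<in>dests. entry x (Passive i) d)"
| "lhs N dN x (Norm (Active i)) =
     entry x (Active i) (To (Passive i))
     + (\<Sum>d\<in>dests - {To (Active i)}. entry x (Active i) d)
     + entry x (Active i) (To (Active i))"
| "lhs N dN x (Norm (Passive i)) =
     (\<Sum>d\<in>dests. entry x (Passive i) d) + entry x (Passive i) (To (Passive i))"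
| "lhs N dN x (Norm Reserve) =
     (\<Sum>d\<in>dests. entry x Reserve d) + entry x Reserve (To Reserve)"

fun rhs :: "('n cluster \<Rightarrow> real) \<Rightarrow> ('n cluster \<Rightarrow> real) \<Rightarrow> real \<Rightarrow> 'n row \<Rightarrow> real" where
  "rhs N N' dN (BalActive i) = N' (Active i) - N (Active i)"
| "rhs N N' dN BalReserve = N' Reserve - N Reserve - dN"
| "rhs N N' dN (BalPassive i) = N' (Passive i) - N (Passive i)"
| "rhs N N' dN (Norm c) = 1"

definition sys_mat :: "('n::finite cluster \<Rightarrow> real) \<Rightarrow> real \<Rightarrow> real ^ 'n edge ^ 'n row" where
  "sys_mat N dN = matrix (\<lambda>x. \<chi> r. lhs N dN x r)"

definition sys_vec ::
  "('n::finite cluster \<Rightarrow> real) \<Rightarrow> ('n cluster \<Rightarrow> real) \<Rightarrow> real \<Rightarrow> real ^ 'n row" where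
  "sys_vec N N' dN = (\<chi> r. rhs N N' dN r)"

lemma linear_lhs: "linear (\<lambda>x. \<chi> r. lhs N dN x r)"
proof (rule linearI)
  fix x y :: "real ^ 'a edge" and c :: real
  show "(\<chi> r. lhs N dN (x + y) r) = (\<chi> r. lhs N dN x r) + (\<chi> r. lhs N dN y r)"
  proof (unfold vec_eq_iff, rule allI)
    fix r
    show "(\<chi> r. lhs N dN (x + y) r) $ r = ((\<chi> r. lhs N dN x r) + (\<chi> r. lhs N dN y r)) $ r"
      by (cases "(N, dN, x, r)" rule: lhs.cases)
        (simp_all add: sum.distrib algebra_simps)
  qed
  show "(\<chi> r. lhs N dN (c *\<^sub>R x) r) = c *\<^sub>R (\<chi> r. lhs N dN x r)"
  proof (unfold vec_eq_iff, rule allI)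
    fix r
    show "(\<chi> r. lhs N dN (c *\<^sub>R x) r) $ r = (c *\<^sub>R (\<chi> r. lhs N dN x r)) $ r"
      by (cases "(N, dN, x, r)" rule: lhs.cases)
        (simp_all add: sum_distrib_left algebra_simps)
  qed
qed

lemma sys_iff: "sys_mat N dN *v x = sys_vec N N' dN \<longleftrightarrow> (\<forall>r. lhs N dN x r = rhs N N' dN r)"
proof -
  have "sys_mat N dN *v x = (\<chi> r. lhs N dN x r)"
    unfolding sys_mat_def
    by (rule matrix_works) (use linear_lhs in \<open>simp add: linear_def scalar_mult_eq_scaleR[abs_def]\<close>)
  then show ?thesis
    by (simp add: sys_vec_def vec_eq_iff)
qed

lemma card_cluster: "CARD('n::finite cluster) = 2 * CARD('n) + 1"
proof -
  have "CARD('n cluster) = card (range (Active :: 'n \<Rightarrow> _)) + (card (range (Passive :: 'n \<Rightarrow> _)) + 1)"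
    unfolding UNIV_cluster by (subst card_Un_disjoint, simp, simp, blast)+ simp
  then show ?thesis
    by (simp add: card_image inj_on_def)
qed

lemma card_row: "CARD('n::finite row) = 4 * CARD('n) + 2"
proof -
  have "CARD('n row) = card (range (BalActive :: 'n \<Rightarrow> _)) + (card (range (BalPassive :: 'n \<Rightarrow> _))
      + (card (range (Norm :: 'n cluster \<Rightarrow> _)) + 1))"
    unfolding UNIV_row by (subst card_Un_disjoint, simp, simp, blast)+ simp
  then show ?thesis
    by (simp add: card_image inj_on_def card_cluster)
qed

lemma card_edge: "CARD('n::finite edge) = 2 * CARD('n)^2 + 5 * CARD('n) + 2"
proof -
  let ?out = "\<lambda>c :: 'n cluster. {d. (c, d) \<in> admissible}"
  have dests: "card (dests :: 'n target set) = CARD('n) + 1"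
    unfolding dests_def by (subst card_insert_disjoint) (auto simp: card_image inj_on_def)
  have out: "?out c = (case c of
       Active i \<Rightarrow> insert (To (Passive i)) dests
     | Passive i \<Rightarrow> insert (To (Passive i)) dests
     | Reserve \<Rightarrow> insert (To Reserve) dests)" for c
    by (cases c) (auto simp: admissible_def passives_def dests_def)
  have "card (?out c) = CARD('n) + 2" for c
    unfolding out
    by (cases c) (simp_all add: dests card_insert_if, auto simp: dests_def)
  then have "card (Sigma UNIV ?out) = (2 * CARD('n) + 1) * (CARD('n) + 2)"
    by (simp add: card_cluster)
  also have "Sigma UNIV ?out = admissible"
    by auto
  finally have "card (admissible :: ('n cluster \<times> 'n target) set) = (2 * CARD('n) + 1) * (CARD('n) + 2)" .
  then show ?thesis
    by (simp add: type_definition.card[OF type_definition_edge] power2_eq_square algebra_simps)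
qed

text \<open>The order on vectors is componentwise.\<close>

definition feasible ::
  "('n::finite cluster \<Rightarrow> real) \<Rightarrow> ('n cluster \<Rightarrow> real) \<Rightarrow> real \<Rightarrow> (real ^ 'n edge) set" where
  "feasible N N' dN = {x. sys_mat N dN *v x = sys_vec N N' dN \<and> 0 \<le> x}"


subsection \<open>Transport plans\<close>

definition to_plan ::
  "('n::finite cluster \<Rightarrow> real) \<Rightarrow> real \<Rightarrow> real ^ 'n edge \<Rightarrow> real ^ 'n edge" where
  "to_plan N dN x = (\<chi> e. mass N dN (fst (ends e)) * x $ e)"

definition transport_polytope ::
  "('n::finite cluster \<Rightarrow> real) \<Rightarrow> ('n cluster \<Rightarrow> real) \<Rightarrow> real \<Rightarrow> (real ^ 'n edge) set" where
  "transport_polytope N N' dN =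
     {z. 0 \<le> z
       \<and> (\<forall>i. (\<Sum>j | (i, j) \<in> admissible. entry z i j) = mass N dN i)
       \<and> (\<forall>c. (\<Sum>i | (i, To c) \<in> admissible. entry z i (To c)) = N' c)}"

definition affine_map_on :: "'a::real_vector set \<Rightarrow> ('a \<Rightarrow> 'b::real_vector) \<Rightarrow> bool" where
  "affine_map_on S f \<longleftrightarrow> (\<exists>L c. linear L \<and> (\<forall>x\<in>S. f x = L x + c))"

definition affine_isomorphism ::
  "('a::real_vector \<Rightarrow> 'b::real_vector) \<Rightarrow> 'a set \<Rightarrow> 'b set \<Rightarrow> bool" where
  "affine_isomorphism f S T \<longleftrightarrow>
     bij_betw f S T \<and> affine_map_on S f \<and> affine_map_on T (inv_into S f)"

definition weighted_cost ::
  "('n::finite cluster \<Rightarrow> real) \<Rightarrow> real \<Rightarrow> real ^ 'n edge \<Rightarrow> real" where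
  "weighted_cost N dN z = (\<Sum>(i, j)\<in>admissible. (entry z i j)\<^sup>2 / (mass N dN i)\<^sup>2)"

definition quadratic_cost :: "real ^ 'n::finite edge \<Rightarrow> real" where
  "quadratic_cost z = (\<Sum>(i, j)\<in>admissible. (entry z i j)\<^sup>2)"

definition unique_minimiser :: "('a \<Rightarrow> real) \<Rightarrow> 'a set \<Rightarrow> 'a \<Rightarrow> bool" where
  "unique_minimiser f S x \<longleftrightarrow> (\<forall>y. is_arg_min f (\<lambda>w. w \<in> S) y \<longleftrightarrow> y = x)"

definition unique_maximiser :: "('a \<Rightarrow> real) \<Rightarrow> 'a set \<Rightarrow> 'a \<Rightarrow> bool" where
  "unique_maximiser f S x \<longleftrightarrow> (\<forall>y. is_arg_max f (\<lambda>w. w \<in> S) y \<longleftrightarrow> y = x)"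


subsection \<open>The outflow simplex of a single source\<close>

definition outflow_simplex :: "(real ^ 'k::finite) set" where
  "outflow_simplex = {q. 0 \<le> q \<and> (\<Sum>r\<in>UNIV. q $ r) = 1}"

text \<open>As \<open>ln 0 = 0\<close>, the convention \<open>0 log 0 = 0\<close> holds.\<close>

definition shannon_entropy :: "real ^ 'k::finite \<Rightarrow> real" where
  "shannon_entropy q = - (\<Sum>r\<in>UNIV. q $ r * ln (q $ r))"

end

theory Submission
  imports Defs
begin

text \<open>
  In the unknowns \<open>x\<close>, the balance and normalisation equations say that every row sums to \<open>1\<close> and every
  mass-weighted column sums to the target count; scaling by the source masses gives the transport
  polytope and turns \<open>(norm x)\<^sup>2\<close> into the weighted cost.  The potentials are the multipliers of the
  row and column constraints in the optimality condition for the minimum-norm point, with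
  potential \<open>0\<close> on the unconstrained departure column.  In \<open>x\<close> they read
  \<open>max (\<alpha> i + N i * b j) 0\<close>, and multiplying by \<open>N i\<close> produces the square of the mass.
\<close>

section \<open>Unique minimisers: existence and transfer\<close>

lemma unique_minimiserI:
  assumes "x \<in> S" and "\<And>y. y \<in> S \<Longrightarrow> y \<noteq> x \<Longrightarrow> f x < f y"
  shows "unique_minimiser f S x"
  unfolding unique_minimiser_def is_arg_min_def
  using assms by (metis less_asym)

text \<open>Minimality depends only on strict comparisons of values, so the cost may also change by
  an increasing transformation, such as squaring the norm or rescaling by a positive
  constant.\<close>

lemma unique_minimiser_bij_betw:
  assumes "unique_minimiser f S x" and h: "bij_betw h S T"
    and less: "\<And>u v. u \<in> S \<Longrightarrow> v \<in> S \<Longrightarrow> g (h u) < g (h v) \<longleftrightarrow> f u < f v"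
  shows "unique_minimiser g T (h x)"
proof -
  have x: "is_arg_min f (\<lambda>w. w \<in> S) y \<longleftrightarrow> y = x" for y
    using assms(1) by (simp add: unique_minimiser_def)
  have T: "T = h ` S" and inj: "inj_on h S"
    using h by (auto simp: bij_betw_def)
  have "is_arg_min g (\<lambda>w. w \<in> T) (h u) \<longleftrightarrow> is_arg_min f (\<lambda>w. w \<in> S) u" if "u \<in> S" for u
    using that less by (auto simp: is_arg_min_def T)
  moreover have "x \<in> S"
    using x[of x] by (simp add: is_arg_min_def)
  ultimately show ?thesis
    unfolding unique_minimiser_def using x T
    by (metis imageE is_arg_min_def)
qed

lemma unique_minimiser_norm_closest_point:
  fixes S :: "'a::euclidean_space set"
  assumes "convex S" "closed S" "S \<noteq> {}"
  shows "unique_minimiser norm S (closest_point S 0)"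
proof (rule unique_minimiserI)
  show "closest_point S 0 \<in> S"
    using assms by (simp add: closest_point_in_set)
  show "norm (closest_point S 0) < norm y" if "y \<in> S" "y \<noteq> closest_point S 0" for y
    using closest_point_lt[OF assms(1,2) that] by simp
qed

section \<open>Projection onto closed cones and the optimality condition\<close>

text \<open>With \<open>k\<close> the nearest point, the variational inequality
  \<open>(x - k) \<bullet> (y - k) \<le> 0\<close> is tested at \<open>k + y\<close>, which gives
  polarity, and at \<open>0\<close> and \<open>k + k\<close>, which give the two signs of
  \<open>(x - k) \<bullet> k\<close>.\<close>

lemma closest_point_convex_cone:
  fixes K :: "'a::euclidean_space set"
  assumes K: "convex_cone K" "closed K"
  shows closest_point_convex_cone_polar: "y \<in> K \<Longrightarrow> (x - closest_point K x) \<bullet> y \<le> 0"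
    and closest_point_convex_cone_orthogonal: "(x - closest_point K x) \<bullet> closest_point K x = 0"
proof -
  define k where "k = closest_point K x"
  have "0 \<in> K" "convex K"
    using K by (simp_all add: convex_cone_contains_0 convex_cone_def)
  then have "k \<in> K"
    unfolding k_def using K by (intro closest_point_in_set) auto
  have dot: "(x - k) \<bullet> (y - k) \<le> 0" if "y \<in> K" for y
    unfolding k_def using closest_point_dot[OF \<open>convex K\<close> K(2) that] .
  show "y \<in> K \<Longrightarrow> (x - closest_point K x) \<bullet> y \<le> 0"
    using dot[OF convex_cone_add[OF K(1) \<open>k \<in> K\<close>], of y] by (simp add: k_def)
  show "(x - closest_point K x) \<bullet> closest_point K x = 0"
    using dot[OF \<open>0 \<in> K\<close>] dot[OF convex_cone_add[OF K(1) \<open>k \<in> K\<close> \<open>k \<in> K\<close>]]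
    by (simp add: k_def)
qed

text \<open>
  The optimality condition says that \<open>x\<close> lies in the cone \<open>K\<close> generated by the range of the adjoint
  \<open>g\<close> and the axes of the vanishing coordinates.  Otherwise the residual \<open>v\<close> of \<open>x\<close> against its
  nearest point of \<open>K\<close> would be nonzero, and moving from \<open>x\<close> along \<open>- v\<close> would stay feasible and
  decrease the norm.  Finite generation is what makes \<open>K\<close> closed.
\<close>

lemma min_norm_nonneg_solution_potential:
  fixes f :: "real ^ 'e \<Rightarrow> 'b::euclidean_space"
  assumes f: "linear f" and g: "linear g" and adj: "\<And>x y. f x \<bullet> y = x \<bullet> g y"
    and x: "f x = d" "0 \<le> x"
    and min: "\<And>y. f y = d \<Longrightarrow> 0 \<le> y \<Longrightarrow> norm x \<le> norm y"
  shows "\<exists>l. \<forall>e. x $ e = max (g l $ e) 0"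
proof -
  \<comment> \<open>Both \<open>g b\<close> and \<open>- g b\<close> are taken, so the multipliers
    of the equations carry no sign; the axes stand for the binding constraints
    \<open>x $ e \<ge> 0\<close>.\<close>
  define G where "G = g ` Basis \<union> (\<lambda>b. - g b) ` Basis \<union> {axis e (1 :: real) | e. x $ e = 0}"
  define K where "K = convex_cone hull G"
  have K: "convex_cone K" "closed K"
    unfolding K_def G_def
    by (intro convex_cone_convex_cone_hull closed_convex_cone_hull finite_UnI finite_imageI
        finite_Basis finite_image_set; simp)+
  define k where "k = closest_point K x"
  define v where "v = x - k"
  have "k \<in> K"
    unfolding k_def using K convex_cone_nonempty by (blast intro: closest_point_in_set)
  \<comment> \<open>Stationarity with complementary slackness: a multiplier part plus a nonnegative
    slack that vanishes wherever \<open>x\<close> is positive.\<close>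
  have "K \<subseteq> {g l + s | l s. 0 \<le> s \<and> (\<forall>e. x $ e > 0 \<longrightarrow> s $ e = 0)}" (is "_ \<subseteq> ?C")
    unfolding K_def
  proof (rule hull_minimal)
    have CI: "w \<in> ?C" if "w = g l + s" "0 \<le> s" "\<And>e. x $ e > 0 \<Longrightarrow> s $ e = 0" for w l s
      using that by auto
    show "G \<subseteq> ?C"
    proof
      fix w assume "w \<in> G"
      then consider b where "w = g b" | b where "w = - g b" | e where "w = axis e 1" "x $ e = 0"
        by (auto simp: G_def)
      then show "w \<in> ?C"
      proof cases
        case (1 b)
        then show ?thesis by (intro CI[of w b 0]) simp_all
      next
        case (2 b)
        then show ?thesis by (intro CI[of w "- b" 0]) (simp_all add: linear_neg[OF g])
      next
        case (3 e)
        then show ?thesis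
          by (intro CI[of w 0 w]) (auto simp: linear_0[OF g] less_eq_vec_def axis_def)
      qed
    qed
    have "0 \<in> ?C"
      by (intro CI[of 0 0 0]) (simp_all add: linear_0[OF g])
    moreover have "y + z \<in> ?C" if yz: "y \<in> ?C" "z \<in> ?C" for y z
    proof -
      obtain l s where "y = g l + s" "0 \<le> s" "\<forall>e. x $ e > 0 \<longrightarrow> s $ e = 0"
        using yz(1) by blast
      moreover obtain l' s' where "z = g l' + s'" "0 \<le> s'" "\<forall>e. x $ e > 0 \<longrightarrow> s' $ e = 0"
        using yz(2) by blast
      ultimately show ?thesis
        by (intro CI[of _ "l + l'" "s + s'"]) (auto simp: linear_add[OF g] less_eq_vec_def)
    qed
    moreover have "c *\<^sub>R y \<in> ?C" if y: "y \<in> ?C" and "c \<ge> 0" for c y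
    proof -
      obtain l s where "y = g l + s" "0 \<le> s" "\<forall>e. x $ e > 0 \<longrightarrow> s $ e = 0"
        using y by blast
      then show ?thesis
        using \<open>c \<ge> 0\<close> by (intro CI[of _ "c *\<^sub>R l" "c *\<^sub>R s"])
          (auto simp: linear_cmul[OF g] less_eq_vec_def scaleR_right_distrib)
    qed
    ultimately show "convex_cone ?C"
      by (simp only: convex_cone_iff) blast
  qed
  with \<open>k \<in> K\<close> obtain l s
    where k: "k = g l + s" "0 \<le> s" "\<forall>e. x $ e > 0 \<longrightarrow> s $ e = 0"
    by blast
  have "v \<bullet> k = 0"
    unfolding v_def k_def using K by (rule closest_point_convex_cone_orthogonal)
  have polar: "v \<bullet> w \<le> 0" if "w \<in> G" for w
    unfolding v_def k_def using K
    by (rule closest_point_convex_cone_polar) (simp add: K_def hull_inc that)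
  \<comment> \<open>Polarity against both signs forces equality, so moving along \<open>v\<close>
    preserves \<open>f x = d\<close>.\<close>
  have "f v \<bullet> b = 0" if "b \<in> Basis" for b
    using polar[of "g b"] polar[of "- g b"] that by (simp add: adj G_def)
  then have "f v = 0"
    by (auto intro!: euclidean_eqI[of "f v"])
  have nonpos: "v $ e \<le> 0" if "\<not> x $ e > 0" for e
  proof -
    have "x $ e = 0"
      using that x(2) by (simp add: less_eq_vec_def order.antisym)
    then have "axis e 1 \<in> G"
      by (auto simp: G_def)
    from polar[OF this] show ?thesis
      by (simp add: inner_axis)
  qed
  \<comment> \<open>Hence the squared norm of \<open>x - t *\<^sub>R v\<close> has derivative
    \<open>- 2 * (v \<bullet> v)\<close> at \<open>t = 0\<close>.\<close>
  have vx: "v \<bullet> x = v \<bullet> v"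
    using \<open>v \<bullet> k = 0\<close> by (simp add: v_def inner_diff_right)
  have "v = 0"
  proof (rule ccontr)
    assume "v \<noteq> 0"
    \<comment> \<open>Positive coordinates survive a small step by continuity; vanishing ones cannot
      decrease, since there \<open>v $ e \<le> 0\<close>.\<close>
    have "\<forall>\<^sub>F t in at_right 0. 0 \<le> x $ e - t * v $ e" for e
    proof (cases "x $ e > 0")
      case True
      have "((\<lambda>t. x $ e - t * v $ e) \<longlongrightarrow> x $ e - 0 * v $ e) (at_right 0)"
        by (intro tendsto_intros)
      with True have "\<forall>\<^sub>F t in at_right 0. 0 < x $ e - t * v $ e"
        by (intro order_tendstoD(1)) auto
      then show ?thesis
        by (rule eventually_mono) simp
    next
      case False
      then have "v $ e \<le> 0" "0 \<le> x $ e"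
        using nonpos x(2) by (auto simp: less_eq_vec_def)
      then have "0 \<le> x $ e - t * v $ e" if "t > 0" for t
        using that mult_nonneg_nonpos[of t "v $ e"] by linarith
      then show ?thesis
        by (auto simp: eventually_at_right_less intro: eventually_mono[OF eventually_at_right_less])
    qed
    then have "\<forall>\<^sub>F t in at_right 0. \<forall>e. 0 \<le> x $ e - t * v $ e"
      by (simp add: eventually_all_finite)
    moreover have "\<forall>\<^sub>F t in at_right (0::real). t < 1"
      by (simp add: eventually_at_right_real[of 0 1] order_tendstoD(2)[OF tendsto_ident_at])
    moreover have "\<forall>\<^sub>F t in at_right (0::real). 0 < t"
      by (rule eventually_at_right_less)
    ultimately have "\<forall>\<^sub>F t in at_right (0::real). (\<forall>e. 0 \<le> x $ e - t * v $ e) \<and> t < 1 \<and> 0 < t"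
      by eventually_elim simp
    then obtain t where t: "\<And>e. 0 \<le> x $ e - t * v $ e" "t < 1" "0 < t"
      by (auto dest!: eventually_happens)
    have "norm x \<le> norm (x - t *\<^sub>R v)"
      using t \<open>f v = 0\<close> x
      by (intro min) (auto simp: less_eq_vec_def linear_diff[OF f] linear_cmul[OF f])
    then have "x \<bullet> x \<le> (x - t *\<^sub>R v) \<bullet> (x - t *\<^sub>R v)"
      by (simp add: norm_le)
    also have "\<dots> = x \<bullet> x - t * (2 - t) * (v \<bullet> v)"
      using vx by (simp add: inner_diff inner_commute algebra_simps)
    finally have "t * (2 - t) * (v \<bullet> v) \<le> 0"
      by simp
    moreover have "t * (2 - t) * (v \<bullet> v) > 0"
      using t \<open>v \<noteq> 0\<close> by simp
    ultimately show False
      by simp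
  qed
  then have "x $ e = g l $ e + s $ e" for e
    using k by (simp add: v_def)
  moreover have "s $ e \<ge> 0" "x $ e \<ge> 0" for e
    using k(2) x(2) by (auto simp: less_eq_vec_def)
  \<comment> \<open>If \<open>x $ e > 0\<close>, the slack vanishes and
    \<open>g l $ e = x $ e\<close>; otherwise \<open>g l $ e = - s $ e \<le> 0\<close> is clipped to
    \<open>0\<close>.\<close>
  ultimately have "x $ e = max (g l $ e) 0" for e
    using k(3)[rule_format, of e] by (smt (verit))
  then show ?thesis
    by blast
qed

section \<open>Norm and entropy on the outflow simplex\<close>

lemma uniform_in_outflow_simplex:
  "(\<chi> r. 1 / real CARD('k::finite)) \<in> (outflow_simplex :: (real ^ 'k) set)"
  by (simp add: outflow_simplex_def less_eq_vec_def)

text \<open>The inner product with the uniform vector sees only the coordinate sum, so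
  \<open>q - ?u\<close> is orthogonal to \<open>?u\<close> and Pythagoras applies.\<close>

lemma unique_minimiser_norm_outflow_simplex:
  "unique_minimiser norm (outflow_simplex :: (real ^ 'k::finite) set) (\<chi> r. 1 / real CARD('k))"
proof (rule unique_minimiserI[OF uniform_in_outflow_simplex])
  let ?u = "(\<chi> r. 1 / real CARD('k)) :: real ^ 'k"
  fix q :: "real ^ 'k"
  assume q: "q \<in> outflow_simplex" "q \<noteq> ?u"
  have inner_u: "w \<bullet> ?u = (\<Sum>r\<in>UNIV. w $ r) / real CARD('k)" for w
    by (simp add: inner_vec_def sum_divide_distrib)
  have "q \<bullet> ?u = ?u \<bullet> ?u"
    using q uniform_in_outflow_simplex by (simp only: inner_u) (simp add: outflow_simplex_def)
  then have "q \<bullet> q = ?u \<bullet> ?u + (q - ?u) \<bullet> (q - ?u)"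
    by (simp add: inner_diff inner_commute)
  then show "norm ?u < norm q"
    using q by (simp add: norm_lt)
qed

text \<open>The right-hand side is the tangent at \<open>c\<close> of the strictly concave function
  \<open>- (q * ln q)\<close>. For \<open>q > 0\<close> the bound is \<open>ln y \<le> y - 1\<close>
  at \<open>y = c / q\<close>, multiplied by \<open>q\<close>.\<close>

lemma entropy_term_le:
  fixes q c :: real
  assumes "c > 0" "q \<ge> 0"
  shows "- (q * ln q) \<le> c - q - q * ln c"
    and "q \<noteq> c \<Longrightarrow> - (q * ln q) < c - q - q * ln c"
proof -
  have "- (q * ln q) < c - q - q * ln c" if "q \<noteq> c"
  proof (cases "q = 0")
    case False
    then have "ln (c / q) < c / q - 1"
      using assms that ln_le_minus_one[of "c / q"] ln_eq_minus_one[of "c / q"]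
      by (fastforce simp: order.strict_iff_order)
    then have "q * ln (c / q) < q * (c / q - 1)"
      using False assms by (intro mult_strict_left_mono) auto
    then show ?thesis
      using False assms by (simp add: ln_div right_diff_distrib)
  qed (use assms in simp)
  then show "q \<noteq> c \<Longrightarrow> - (q * ln q) < c - q - q * ln c"
    and "- (q * ln q) \<le> c - q - q * ln c"
    by (auto simp: less_imp_le) (cases "q = c"; fastforce)
qed

text \<open>The tangent bounds at the uniform value are affine in \<open>q\<close> with a common
  slope, so their sum is constant on the simplex; away from the uniform point one of them is
  strict.\<close>

lemma unique_maximiser_shannon_entropy:
  "unique_maximiser shannon_entropy (outflow_simplex :: (real ^ 'k::finite) set)
    (\<chi> r. 1 / real CARD('k))"
proof -
  let ?u = "(\<chi> r. 1 / real CARD('k)) :: real ^ 'k"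
  define c where "c = 1 / real CARD('k)"
  have c: "c > 0" "real CARD('k) * c = 1"
    by (simp_all add: c_def)
  have "shannon_entropy q < shannon_entropy ?u" if q: "q \<in> outflow_simplex" "q \<noteq> ?u" for q :: "real ^ 'k"
  proof -
    obtain r where "q $ r \<noteq> c"
      using q(2) by (auto simp: vec_eq_iff c_def)
    moreover have "0 \<le> q $ r" for r
      using q by (simp add: outflow_simplex_def less_eq_vec_def)
    ultimately have "(\<Sum>r\<in>UNIV. - (q $ r * ln (q $ r))) < (\<Sum>r\<in>UNIV. c - q $ r - q $ r * ln c)"
      using c by (intro sum_strict_mono_ex1) (auto intro: entropy_term_le)
    also have "\<dots> = - ln c"
      using q c by (simp add: outflow_simplex_def sum_subtractf flip: sum_distrib_right)
    also have "\<dots> = shannon_entropy ?u"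
      using c by (simp add: shannon_entropy_def flip: c_def)
    finally show ?thesis
      by (simp add: shannon_entropy_def sum_negf)
  qed
  then show ?thesis
    unfolding unique_maximiser_def is_arg_max_def
    using uniform_in_outflow_simplex by (metis less_asym)
qed

section \<open>Admissible edges, and the linear system as row and column sums\<close>

lemma sum_admissible: "(\<Sum>p\<in>admissible. h p) = (\<Sum>e\<in>UNIV. h (ends e))"
  by (rule sum.reindex_bij_witness[of _ ends edge]) (auto simp: edge_inverse ends_inverse ends)

lemma sum_row:
  "(\<Sum>j | (i, j) \<in> admissible. h (edge (i, j))) = (\<Sum>e | fst (ends e) = i. h e)"
  by (rule sum.reindex_bij_witness[of _ "snd \<circ> ends" "\<lambda>j. edge (i, j)"])
    (auto simp: edge_inverse ends_inverse, (metis ends prod.collapse)+)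

lemma sum_column:
  "(\<Sum>i | (i, j) \<in> admissible. h (edge (i, j))) = (\<Sum>e | snd (ends e) = j. h e)"
  by (rule sum.reindex_bij_witness[of _ "fst \<circ> ends" "\<lambda>i. edge (i, j)"])
    (auto simp: edge_inverse ends_inverse, (metis ends prod.collapse)+)

lemma admissible_from:
  "{d. (Active i, d) \<in> admissible} = insert (To (Passive i)) dests"
  "{d. (Passive i, d) \<in> admissible} = insert (To (Passive i)) dests"
  "{d. (Reserve, d) \<in> admissible} = insert (To Reserve) dests"
  by (auto simp: admissible_def passives_def dests_def)

text \<open>The families P21, P11 and P** fill an active column; a passive column gets only P12 and
  P*, and the reserve column only P*, since no active cluster feeds the reserve.\<close>

lemma admissible_to:
  "{c. (c, To (Active i)) \<in> admissible} = UNIV"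
  "{c. (c, To (Passive i)) \<in> admissible} = {Active i, Passive i}"
  "{c. (c, To Reserve) \<in> admissible} = {Reserve}"
proof -
  show "{c. (c, To (Active i)) \<in> admissible} = UNIV"
  proof (intro set_eqI)
    fix c show "c \<in> {c. (c, To (Active i)) \<in> admissible} \<longleftrightarrow> c \<in> UNIV"
      by (cases c) (auto simp: admissible_def passives_def dests_def)
  qed
qed (auto simp: admissible_def passives_def dests_def)

lemma active_in_dests: "To (Active i) \<in> dests"
  by (simp add: dests_def)

lemma passive_notin_dests [simp]: "To (Passive i) \<notin> dests" "To Reserve \<notin> dests"
  by (auto simp: dests_def)

lemma sum_cluster:
  fixes h :: "'n::finite cluster \<Rightarrow> 'a::comm_monoid_add"
  shows "sum h UNIV = (\<Sum>i\<in>UNIV. h (Active i)) + ((\<Sum>i\<in>UNIV. h (Passive i)) + h Reserve)"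
proof -
  have "sum h UNIV = sum h (range Active) + (sum h (range Passive) + h Reserve)"
    unfolding UNIV_cluster by (subst sum.union_disjoint, simp, simp, blast)+ simp
  then show ?thesis
    by (simp add: sum.reindex inj_on_def)
qed

lemma all_cluster: "(\<forall>c. P c) \<longleftrightarrow> (\<forall>i. P (Active i)) \<and> (\<forall>i. P (Passive i)) \<and> P Reserve"
  by (metis cluster.exhaust)

lemma all_row:
  "(\<forall>r. P r) \<longleftrightarrow> (\<forall>i. P (BalActive i)) \<and> P BalReserve \<and> (\<forall>i. P (BalPassive i)) \<and> (\<forall>c. P (Norm c))"
  by (metis row.exhaust)

text \<open>Adding \<open>N\<^sup>(i)\<close> times the normalisation of source \<open>i\<close> to its balance equation gives the column sum.\<close>

lemma lhs_eq_rhs_iff: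
  "(\<forall>r. lhs N dN x r = rhs N N' dN r) \<longleftrightarrow>
     (\<forall>i. (\<Sum>j | (i, j) \<in> admissible. entry x i j) = 1)
   \<and> (\<forall>c. (\<Sum>i | (i, To c) \<in> admissible. mass N dN i * entry x i (To c)) = N' c)"
proof -
  have norm: "lhs N dN x (Norm i) = (\<Sum>j | (i, j) \<in> admissible. entry x i j)" for i
  proof (cases i)
    case (Active k)
    then show ?thesis
      using sum.remove[OF finite active_in_dests, of "entry x i" k] by (simp add: admissible_from)
  qed (simp_all add: admissible_from)
  have bal_active: "(lhs N dN x (BalActive i) = rhs N N' dN (BalActive i) \<longleftrightarrow>
        (\<Sum>c | (c, To (Active i)) \<in> admissible. mass N dN c * entry x c (To (Active i))) = N' (Active i))"
    if "lhs N dN x (Norm (Active i)) = 1" for i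
  proof -
    \<comment> \<open>In the balance equation the \<open>1\<close> cancels
      \<open>- N (Active i)\<close> on the right, and the remaining entry supplies the diagonal term
      missing from the column sum.\<close>
    have *: "entry x (Active i) (To (Passive i)) + (\<Sum>d\<in>dests - {To (Active i)}. entry x (Active i) d)
        = 1 - entry x (Active i) (To (Active i))"
      using that by simp
    show ?thesis
      unfolding lhs.simps rhs.simps *
      by (simp add: admissible_to sum_cluster sum.remove[of UNIV i] algebra_simps)
  qed
  have bal_passive: "(lhs N dN x (BalPassive i) = rhs N N' dN (BalPassive i) \<longleftrightarrow>
        (\<Sum>c | (c, To (Passive i)) \<in> admissible. mass N dN c * entry x c (To (Passive i))) = N' (Passive i))"
    if "lhs N dN x (Norm (Passive i)) = 1" for i
  proof -
    have "(\<Sum>d\<in>dests. entry x (Passive i) d) = 1 - entry x (Passive i) (To (Passive i))"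
      using that by simp
    then show ?thesis
      by (simp add: admissible_to) (simp add: algebra_simps)
  qed
  have bal_reserve: "(lhs N dN x BalReserve = rhs N N' dN BalReserve \<longleftrightarrow>
        (\<Sum>c | (c, To Reserve) \<in> admissible. mass N dN c * entry x c (To Reserve)) = N' Reserve)"
    if "lhs N dN x (Norm Reserve) = 1"
  proof -
    have "(\<Sum>d\<in>dests. entry x Reserve d) = 1 - entry x Reserve (To Reserve)"
      using that by simp
    then show ?thesis
      by (simp add: admissible_to) (simp add: algebra_simps)
  qed
  \<comment> \<open>Balance rows become column sums only modulo the normalisation rows, which are
    therefore assumed here.\<close>
  have "(\<forall>r. lhs N dN x r = rhs N N' dN r) \<longleftrightarrow>
      (\<forall>c. (\<Sum>i | (i, To c) \<in> admissible. mass N dN i * entry x i (To c)) = N' c)"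
    if "\<forall>c. lhs N dN x (Norm c) = 1"
    using that bal_active bal_passive bal_reserve
    unfolding all_row all_cluster[of "\<lambda>c. (\<Sum>i | (i, To c) \<in> admissible. _ i c) = N' c"]
    by (simp del: lhs.simps) blast
  moreover have "\<forall>c. lhs N dN x (Norm c) = 1" if "\<forall>r. lhs N dN x r = rhs N N' dN r"
    using that by (simp del: lhs.simps)
  ultimately show ?thesis
    unfolding norm by blast
qed

lemma feasible_iff:
  "x \<in> feasible N N' dN \<longleftrightarrow> 0 \<le> x
     \<and> (\<forall>i. (\<Sum>j | (i, j) \<in> admissible. entry x i j) = 1)
     \<and> (\<forall>c. (\<Sum>i | (i, To c) \<in> admissible. mass N dN i * entry x i (To c)) = N' c)"
  by (auto simp: feasible_def sys_iff lhs_eq_rhs_iff)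

section \<open>Convexity and closedness of the feasible set\<close>

lemma convex_feasible: "convex (feasible N N' dN)"
proof -
  have "convex {x. sys_mat N dN *v x = sys_vec N N' dN}"
    by (auto simp: convex_def matrix_vector_right_distrib matrix_vector_mult_scaleR
        simp flip: scaleR_left_distrib)
  moreover have "convex {x :: real ^ 'a edge. 0 \<le> x}"
    by (auto simp: convex_def less_eq_vec_def)
  ultimately show ?thesis
    unfolding feasible_def Collect_conj_eq by (rule convex_Int)
qed

lemma closed_feasible: "closed (feasible N N' dN)"
proof -
  have "closed {x. sys_mat N dN *v x = sys_vec N N' dN}"
    by (intro closed_Collect_eq continuous_intros)
  moreover have "closed {x :: real ^ 'a edge. 0 \<le> x}"
    unfolding less_eq_vec_def Collect_all_eq
    by (intro closed_INT ballI closed_Collect_le continuous_intros)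
  ultimately show ?thesis
    unfolding feasible_def Collect_conj_eq by (rule closed_Int)
qed

section \<open>Marginals, their adjoint and the potentials\<close>

text \<open>Only prescribed sums are recorded, so the departure column is absent. The pair of
  vectors lies in a Euclidean space whose inner product pairs it with row and column
  multipliers.\<close>

definition marginals ::
  "('n::finite cluster \<Rightarrow> real) \<Rightarrow> real \<Rightarrow> real ^ 'n edge \<Rightarrow> (real ^ 'n cluster) \<times> (real ^ 'n cluster)" where
  "marginals N dN x =
     (\<chi> i. \<Sum>e | fst (ends e) = i. x $ e,
      \<chi> c. \<Sum>e | snd (ends e) = To c. mass N dN (fst (ends e)) * x $ e)"

definition potential :: "real ^ 'n::finite cluster \<Rightarrow> 'n target \<Rightarrow> real" where
  "potential b d = (case d of To c \<Rightarrow> b $ c | Dep \<Rightarrow> 0)"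

text \<open>The adjoint of \<open>marginals\<close>; the mass factor is the weight of an edge in its
  column sum.\<close>

definition potential_sum ::
  "('n::finite cluster \<Rightarrow> real) \<Rightarrow> real \<Rightarrow> (real ^ 'n cluster) \<times> (real ^ 'n cluster) \<Rightarrow> real ^ 'n edge" where
  "potential_sum N dN l =
     (\<chi> e. fst l $ fst (ends e) + mass N dN (fst (ends e)) * potential (snd l) (snd (ends e)))"

lemma linear_marginals: "linear (marginals N dN)"
  by (rule linearI)
    (auto simp: marginals_def vec_eq_iff sum.distrib algebra_simps sum_distrib_left)

lemma linear_potential_sum: "linear (potential_sum N dN)"
  by (rule linearI)
    (auto simp: potential_sum_def potential_def vec_eq_iff algebra_simps split: target.splits)

lemma marginals_adjoint: "marginals N dN x \<bullet> l = x \<bullet> potential_sum N dN l"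
proof -
  have "(\<Sum>i\<in>UNIV. (\<Sum>e | fst (ends e) = i. x $ e) * fst l $ i) = (\<Sum>e\<in>UNIV. x $ e * fst l $ fst (ends e))"
  proof -
    have "(\<Sum>i\<in>UNIV. (\<Sum>e | fst (ends e) = i. x $ e) * fst l $ i)
        = (\<Sum>i\<in>UNIV. \<Sum>e | e \<in> UNIV \<and> fst (ends e) = i. x $ e * fst l $ fst (ends e))"
      by (simp add: sum_distrib_right)
    also have "\<dots> = (\<Sum>e\<in>UNIV. x $ e * fst l $ fst (ends e))"
      by (rule sum.group) auto
    finally show ?thesis .
  qed
  moreover have "(\<Sum>c\<in>UNIV. (\<Sum>e | snd (ends e) = To c. mass N dN (fst (ends e)) * x $ e) * snd l $ c)
      = (\<Sum>e\<in>UNIV. x $ e * (mass N dN (fst (ends e)) * potential (snd l) (snd (ends e))))"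
  proof -
    let ?h = "\<lambda>e. x $ e * (mass N dN (fst (ends e)) * potential (snd l) (snd (ends e)))"
    have "(\<Sum>e\<in>UNIV. ?h e) = (\<Sum>d\<in>UNIV. \<Sum>e | e \<in> UNIV \<and> snd (ends e) = d. ?h e)"
      by (rule sum.group[symmetric]) auto
    \<comment> \<open>The departure group is split off; it contributes nothing because its potential
      is \<open>0\<close>.\<close>
    also have "\<dots> = (\<Sum>e | snd (ends e) = Dep. ?h e) + (\<Sum>c\<in>UNIV. \<Sum>e | snd (ends e) = To c. ?h e)"
      unfolding UNIV_target by (subst sum.insert) (auto simp: sum.reindex inj_on_def)
    also have "\<dots> = (\<Sum>c\<in>UNIV. (\<Sum>e | snd (ends e) = To c. mass N dN (fst (ends e)) * x $ e) * snd l $ c)"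
      by (simp add: potential_def sum_distrib_left mult_ac)
    finally show ?thesis
      by simp
  qed
  ultimately show ?thesis
    by (simp add: marginals_def potential_sum_def inner_prod_def inner_vec_def sum.distrib distrib_left)
qed

text \<open>Brings the feasible set into the form \<open>f x = d\<close>, \<open>0 \<le> x\<close>
  with an \<open>f\<close> whose adjoint consists of potentials.\<close>

lemma feasible_eq_marginals:
  "feasible N N' dN = {x. marginals N dN x = (1, \<chi> c. N' c) \<and> 0 \<le> x}"
proof -
  have "(\<Sum>j | (i, j) \<in> admissible. entry x i j) = fst (marginals N dN x) $ i" for x i
    by (simp add: marginals_def sum_row[where h = "($) x"])
  moreover have "(\<Sum>i | (i, To c) \<in> admissible. mass N dN i * entry x i (To c)) = snd (marginals N dN x) $ c"
    for x c
  proof -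
    have "(\<Sum>i | (i, To c) \<in> admissible. mass N dN i * entry x i (To c))
      = (\<Sum>i | (i, To c) \<in> admissible. mass N dN (fst (ends (edge (i, To c)))) * x $ edge (i, To c))"
      by (rule sum.cong) (simp_all add: edge_inverse)
    also have "\<dots> = (\<Sum>e | snd (ends e) = To c. mass N dN (fst (ends e)) * x $ e)"
      by (rule sum_column)
    finally show ?thesis
      by (simp add: marginals_def)
  qed
  ultimately show ?thesis
    by (auto simp: set_eq_iff feasible_iff prod_eq_iff vec_eq_iff)
qed

lemma min_norm_feasible_potentials:
  assumes "unique_minimiser norm (feasible N N' dN) x"
  obtains a b where "\<And>e. x $ e = max (a (fst (ends e)) + mass N dN (fst (ends e)) * b (snd (ends e))) 0"
proof -
  have "is_arg_min norm (\<lambda>w. w \<in> feasible N N' dN) x"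
    using assms by (simp add: unique_minimiser_def)
  then have "\<exists>l. \<forall>e. x $ e = max (potential_sum N dN l $ e) 0"
    by (intro min_norm_nonneg_solution_potential[OF linear_marginals linear_potential_sum marginals_adjoint])
      (auto simp: is_arg_min_def feasible_eq_marginals not_less)
  then obtain l where "\<And>e. x $ e = max (potential_sum N dN l $ e) 0"
    by blast
  then show thesis
    by (intro that[of "($) (fst l)" "potential (snd l)"]) (simp add: potential_sum_def)
qed

section \<open>Scaling by the source masses\<close>

lemma entry_to_plan:
  "(i, j) \<in> admissible \<Longrightarrow> entry (to_plan N dN x) i j = mass N dN i * entry x i j"
  by (simp add: to_plan_def edge_inverse)

definition from_plan ::
  "('n::finite cluster \<Rightarrow> real) \<Rightarrow> real \<Rightarrow> real ^ 'n edge \<Rightarrow> real ^ 'n edge" where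
  "from_plan N dN z = (\<chi> e. z $ e / mass N dN (fst (ends e)))"

context
  fixes N :: "'n::finite cluster \<Rightarrow> real" and dN :: real
  assumes mass_pos: "\<And>i. mass N dN i > 0"
begin

text \<open>Row equations are multiplied by their positive masses, column equations stay the same,
  and signs are preserved both ways.\<close>

lemma to_plan_mem_iff:
  "to_plan N dN x \<in> transport_polytope N N' dN \<longleftrightarrow> x \<in> feasible N N' dN"
proof -
  have "0 \<le> to_plan N dN x \<longleftrightarrow> 0 \<le> x"
    using mass_pos by (simp add: less_eq_vec_def to_plan_def zero_le_mult_iff less_imp_le not_le[THEN iffD2])
  moreover have "(\<Sum>j | (i, j) \<in> admissible. entry (to_plan N dN x) i j) = mass N dN i
      \<longleftrightarrow> (\<Sum>j | (i, j) \<in> admissible. entry x i j) = 1" for i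
    using mass_pos[of i] by (simp add: entry_to_plan flip: sum_distrib_left)
  ultimately show ?thesis
    by (simp add: transport_polytope_def feasible_iff entry_to_plan)
qed

lemma from_plan_inverse [simp]:
  "to_plan N dN (from_plan N dN z) = z" "from_plan N dN (to_plan N dN x) = x"
  using mass_pos by (simp_all add: from_plan_def to_plan_def vec_eq_iff less_imp_neq[symmetric])

lemma bij_betw_to_plan:
  "bij_betw (to_plan N dN) (feasible N N' dN) (transport_polytope N N' dN)"
  by (rule bij_betw_byWitness[where f' = "from_plan N dN"])
    (auto simp: to_plan_mem_iff simp flip: to_plan_mem_iff[of "from_plan N dN _"])

lemma affine_isomorphism_to_plan:
  "affine_isomorphism (to_plan N dN) (feasible N N' dN) (transport_polytope N N' dN)"
proof -
  \<comment> \<open>\<open>inv_into\<close> is determined only on the image, and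
    \<open>affine_map_on\<close> asks for an affine formula only there.\<close>
  have inv: "inv_into (feasible N N' dN) (to_plan N dN) z = from_plan N dN z"
    if "z \<in> transport_polytope N N' dN" for z
    using that bij_betw_to_plan to_plan_mem_iff[of "from_plan N dN z"]
    by (intro inv_into_f_eq) (auto simp: bij_betw_def)
  have "linear (to_plan N dN)" "linear (from_plan N dN)"
    by (auto intro!: linearI simp: to_plan_def from_plan_def vec_eq_iff algebra_simps add_divide_distrib)
  then show ?thesis
    unfolding affine_isomorphism_def affine_map_on_def
    using bij_betw_to_plan inv by (metis add_0_right)
qed

text \<open>The squared mass produced by the scaling cancels the weight, edge by edge.\<close>

lemma weighted_cost_to_plan: "weighted_cost N dN (to_plan N dN x) = (norm x)\<^sup>2"
proof -
  have "weighted_cost N dN (to_plan N dN x) = (\<Sum>e\<in>UNIV. (x $ e)\<^sup>2)"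
    unfolding weighted_cost_def sum_admissible
    using mass_pos by (intro sum.cong)
      (auto simp: case_prod_unfold ends_inverse to_plan_def power_mult_distrib less_imp_neq[symmetric])
  also have "\<dots> = (norm x)\<^sup>2"
    unfolding power2_norm_eq_inner by (simp add: inner_vec_def power2_eq_square)
  finally show ?thesis .
qed

lemma weighted_minimiser:
  assumes "feasible N N' dN \<noteq> {}"
  obtains x where "unique_minimiser norm (feasible N N' dN) x"
    "unique_minimiser (weighted_cost N dN) (transport_polytope N N' dN) (to_plan N dN x)"
    "\<exists>a b. \<forall>(i, j)\<in>admissible.
       entry (to_plan N dN x) i j = max (a i + (mass N dN i)\<^sup>2 * b j) 0"
proof -
  define x where "x = closest_point (feasible N N' dN) 0"
  have x: "unique_minimiser norm (feasible N N' dN) x"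
    unfolding x_def
    by (intro unique_minimiser_norm_closest_point convex_feasible closed_feasible assms)
  moreover have "unique_minimiser (weighted_cost N dN) (transport_polytope N N' dN) (to_plan N dN x)"
    using x bij_betw_to_plan
    by (rule unique_minimiser_bij_betw) (simp add: weighted_cost_to_plan power2_norm_eq_inner norm_lt)
  moreover obtain a b where ab:
    "\<And>e. x $ e = max (a (fst (ends e)) + mass N dN (fst (ends e)) * b (snd (ends e))) 0"
    using min_norm_feasible_potentials[OF x] by blast
  have "entry (to_plan N dN x) i j = max (mass N dN i * a i + (mass N dN i)\<^sup>2 * b j) 0"
    if "(i, j) \<in> admissible" for i j
    using that mass_pos[of i]
    by (simp add: entry_to_plan ab edge_inverse max_mult_distrib_left power2_eq_square algebra_simps)
  then have "\<exists>a b. \<forall>(i, j)\<in>admissible.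
       entry (to_plan N dN x) i j = max (a i + (mass N dN i)\<^sup>2 * b j) 0"
    by (intro exI[of _ "\<lambda>i. mass N dN i * a i"] exI[of _ b]) auto
  ultimately show thesis
    by (rule that)
qed

end

section \<open>Equal masses and the combined statement\<close>

lemma weighted_cost_equal_masses:
  assumes "\<And>i. mass N dN i = c"
  shows "weighted_cost N dN z = quadratic_cost z / c\<^sup>2"
  by (simp add: weighted_cost_def quadratic_cost_def assms sum_divide_distrib case_prod_unfold)

theorem proposition2:
  fixes N N' :: "'n::finite cluster \<Rightarrow> real" and dN :: real
  assumes "\<And>c. N c > 0" and "\<And>c. N' c \<ge> 0" and "dN \<ge> 0"
  shows
    "(affine_isomorphism (to_plan N dN) (feasible N N' dN) (transport_polytope N N' dN)
      \<and> (\<forall>i. card {c :: 'n cluster. (c, To (Passive i)) \<in> admissible} = 2)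
      \<and> card {c :: 'n cluster. (c, To Reserve) \<in> admissible} = 1
      \<and> (\<forall>z\<in>transport_polytope N N' dN.
            (\<Sum>j | (Reserve, j) \<in> admissible. entry z Reserve j) = dN + N Reserve))
     \<and> (feasible N N' dN \<noteq> {} \<longrightarrow>
        (\<exists>x z. unique_minimiser norm (feasible N N' dN) x
          \<and> unique_minimiser (weighted_cost N dN) (transport_polytope N N' dN) z
          \<and> z = to_plan N dN x
          \<and> (\<exists>a b. \<forall>(i, j)\<in>admissible. entry z i j = max (a i + (mass N dN i)\<^sup>2 * b j) 0)))
     \<and> (feasible N N' dN \<noteq> {} \<and> (\<exists>c. \<forall>i. mass N dN i = c) \<longrightarrow>
        (\<exists>z. unique_minimiser (weighted_cost N dN) (transport_polytope N N' dN) z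
          \<and> unique_minimiser quadratic_cost (transport_polytope N N' dN) z
          \<and> (\<exists>a b. \<forall>(i, j)\<in>admissible. entry z i j = max (a i + b j) 0)))
     \<and> (unique_minimiser norm (outflow_simplex :: (real ^ 'k::finite) set)
          (\<chi> r. 1 / real CARD('k))
        \<and> unique_maximiser shannon_entropy (outflow_simplex :: (real ^ 'k) set)
          (\<chi> r. 1 / real CARD('k)))"
proof -
  have pos: "mass N dN i > 0" for i
    using assms(1)[of i] assms(3) by (cases i) auto
  have shape: "\<forall>i. card {c :: 'n cluster. (c, To (Passive i)) \<in> admissible} = 2"
    "card {c :: 'n cluster. (c, To Reserve) \<in> admissible} = 1"
    "\<forall>z\<in>transport_polytope N N' dN.
       (\<Sum>j | (Reserve, j) \<in> admissible. entry z Reserve j) = dN + N Reserve"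
    by (simp_all add: admissible_to transport_polytope_def)
  have weighted: "\<exists>x z. unique_minimiser norm (feasible N N' dN) x
      \<and> unique_minimiser (weighted_cost N dN) (transport_polytope N N' dN) z
      \<and> z = to_plan N dN x
      \<and> (\<exists>a b. \<forall>(i, j)\<in>admissible. entry z i j = max (a i + (mass N dN i)\<^sup>2 * b j) 0)"
    if ne: "feasible N N' dN \<noteq> {}"
  proof -
    obtain x where "unique_minimiser norm (feasible N N' dN) x"
      "unique_minimiser (weighted_cost N dN) (transport_polytope N N' dN) (to_plan N dN x)"
      "\<exists>a b. \<forall>(i, j)\<in>admissible.
         entry (to_plan N dN x) i j = max (a i + (mass N dN i)\<^sup>2 * b j) 0"
      by (rule weighted_minimiser[OF pos ne])
    then show ?thesis
      by (intro exI[of _ x] exI[of _ "to_plan N dN x"] conjI refl)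
  qed
  have equal: "\<exists>z. unique_minimiser (weighted_cost N dN) (transport_polytope N N' dN) z
      \<and> unique_minimiser quadratic_cost (transport_polytope N N' dN) z
      \<and> (\<exists>a b. \<forall>(i, j)\<in>admissible. entry z i j = max (a i + b j) 0)"
    if ne: "feasible N N' dN \<noteq> {}" and eq: "\<exists>c. \<forall>i. mass N dN i = c"
  proof -
    obtain c where c: "\<And>i. mass N dN i = c"
      using eq by blast
    have "c > 0"
      using pos[of Reserve] by (simp only: c)
    obtain z a b where z: "unique_minimiser (weighted_cost N dN) (transport_polytope N N' dN) z"
      and ab: "\<forall>(i, j)\<in>admissible. entry z i j = max (a i + (mass N dN i)\<^sup>2 * b j) 0"
      using weighted[OF ne] by blast
    \<comment> \<open>The plan itself does not change, so the transfer runs along the identity;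
      division by \<open>c\<^sup>2 > 0\<close> preserves strict comparisons.\<close>
    have "unique_minimiser quadratic_cost (transport_polytope N N' dN) (id z)"
      using z bij_betw_id
      by (rule unique_minimiser_bij_betw)
        (use \<open>c > 0\<close> in \<open>simp add: weighted_cost_equal_masses[OF c] divide_less_cancel\<close>)
    moreover have "\<forall>(i, j)\<in>admissible. entry z i j = max (a i + c\<^sup>2 * b j) 0"
      using ab by (simp add: c)
    ultimately show ?thesis
      using z by (intro exI[of _ z] conjI exI[of _ a] exI[of _ "\<lambda>j. c\<^sup>2 * b j"]) simp_all
  qed
  show ?thesis
    using affine_isomorphism_to_plan[OF pos] shape weighted equal
      unique_minimiser_norm_outflow_simplex unique_maximiser_shannon_entropy
    by blast
qed

end
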